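(* Let $(\mathcal{F}=\mathcal{F}^{+}\dot{+}\mathcal{F}^{-},[\cdot,\cdot],\mathcal{J})$ be a Krein space with the standardized two-inner product $$\psi(x,y,z)=[x^{+},y^{+}]\,\|z^{+}\|_{+}^{2}+[x^{-},y^{-}]\,\|z^{-}\|_{-}^{2},$$ and let $t\in\mathcal{F}$. Then $(\mathcal{F}^{+},\psi)$ and $(\mathcal{F}^{-},-\psi)$ are $t$-Hilbert spaces.
   Context: A Krein space is a pair $(\mathcal{F},[\cdot,\cdot])$ where $\mathcal{F}$ is a complex vector space and $[\cdot,\cdot]$ is an indefinite inner product (a Hermitian sesquilinear form, linear in the first variable) admitting a direct sum decomposition $\mathcal{F}=\mathcal{F}^{+}\dot{+}\mathcal{F}^{-}$ into mutually $[\cdot,\cdot]$-orthogonal subspaces (a fundamental decomposition) such that $(\mathcal{F}^{+},[\cdot,\cdot])$ and $(\mathcal{F}^{-},-[\cdot,\cdot])$ are Hilbert spaces. Each $x\in\mathcal{F}$ is written $x=x^{+}+x^{-}$ with $x^{\pm}\in\mathcal{F}^{\pm}$; $\mathcal{J}x=x^{+}-x^{-}$; $\|x^{+}\|_{+}=\sqrt{[x^{+},x^{+}]}$ and $\|x^{-}\|_{-}=\sqrt{-[x^{-},x^{-}]}$. The axioms of a two-inner product $\phi:F\times F\times F\to\mathbb{C}$ on a complex vector space $F$ are: $\phi(g_1+g_2,u,h)=\phi(g_1,u,h)+\phi(g_2,u,h)$; $\phi(g,g,h)=\phi(h,h,g)$; $\phi(u,g,h)=\overline{\phi(g,u,h)}$;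 $\phi(\alpha g,u,h)=\alpha\phi(g,u,h)$ for $\alpha\in\mathbb{C}$; $\phi(g,g,h)\ge 0$. The two-norms induced on $\mathcal{F}^{\pm}$ are $\mathcal{N}^{+}(x^{+},y^{+})=\sqrt{\psi(x^{+},x^{+},y^{+})}=\|x^{+}\|_{+}\|y^{+}\|_{+}$ and $\mathcal{N}^{-}(x^{-},y^{-})=\sqrt{-\psi(x^{-},x^{-},y^{-})}=\|x^{-}\|_{-}\|y^{-}\|_{-}$. For $t=t^{+}+t^{-}\in\mathcal{F}$, a sequence $(x_n)$ in $\mathcal{F}^{\pm}$ is $t$-Cauchy if for every $\epsilon>0$ there is $N\in\mathbb{N}$ with $\mathcal{N}^{\pm}(x_n-x_m,t^{\pm})<\epsilon$ for all $m,n>N$. "$(\mathcal{F}^{+},\psi)$ (respectively $(\mathcal{F}^{-},-\psi)$) is a $t$-Hilbert space" means that $\psi$ (respectively $-\psi$) restricted to it satisfies the axioms of a two-inner product and that for every $t$-Cauchy sequence $(x_n)$ in it there is $x$ in it with $\lim_{n\to\infty}\mathcal{N}^{\pm}(x_n-x,t^{\pm})=0$. *)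

theory Defs
  imports "HOL-Analysis.Analysis"
begin

(* A complex vector space is an abelian group type 'a with a scalar multiplication
   satisfying the library locale vector_space; subspaces are subsets V of 'a. *)

definition hermitian_form_on ::
  "(complex \<Rightarrow> 'a::ab_group_add \<Rightarrow> 'a) \<Rightarrow> 'a set \<Rightarrow> ('a \<Rightarrow> 'a \<Rightarrow> complex) \<Rightarrow> bool" where
  "hermitian_form_on smul V B \<longleftrightarrow>
     (\<forall>x\<in>V. \<forall>y\<in>V. \<forall>z\<in>V. B (x + y) z = B x z + B y z) \<and>
     (\<forall>a. \<forall>x\<in>V. \<forall>y\<in>V. B (smul a x) y = a * B x y) \<and>
     (\<forall>x\<in>V. \<forall>y\<in>V. B y x = cnj (B x y))"

definition form_norm :: "('a \<Rightarrow> 'a \<Rightarrow> complex) \<Rightarrow> 'a \<Rightarrow> real" where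
  "form_norm B x = sqrt (Re (B x x))"

(* Completeness is spelled out because Metric_space.mcomplete needs a distance that is
   nonnegative on the whole type, while B need not be positive outside V. *)
definition hilbert_space_on ::
  "(complex \<Rightarrow> 'a::ab_group_add \<Rightarrow> 'a) \<Rightarrow> 'a set \<Rightarrow> ('a \<Rightarrow> 'a \<Rightarrow> complex) \<Rightarrow> bool" where
  "hilbert_space_on smul V B \<longleftrightarrow>
     vector_space smul \<and> module.subspace smul V \<and>
     hermitian_form_on smul V B \<and>
     (\<forall>x\<in>V. x \<noteq> 0 \<longrightarrow> 0 < Re (B x x)) \<and>
     (\<forall>X. range X \<subseteq> V \<longrightarrow>
        (\<forall>\<epsilon>>0. \<exists>N. \<forall>m\<ge>N. \<forall>n\<ge>N. form_norm B (X m - X n) < \<epsilon>) \<longrightarrow>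
        (\<exists>x\<in>V. (\<lambda>n. form_norm B (X n - x)) \<longlonglongrightarrow> 0))"

(* The U-component of x with respect to a direct sum decomposition U + W;
   thus x\<^sup>+ is component Fp Fm x and x\<^sup>- is component Fm Fp x. *)
definition component :: "'a::ab_group_add set \<Rightarrow> 'a set \<Rightarrow> 'a \<Rightarrow> 'a" where
  "component U W x = (THE u. u \<in> U \<and> (\<exists>w\<in>W. x = u + w))"

(* "Indefinite" only means that no sign is imposed on the form: Fp or Fm may be trivial. *)
locale krein_space = vector_space smul
  for smul :: "complex \<Rightarrow> 'a::ab_group_add \<Rightarrow> 'a" +
  fixes ip :: "'a \<Rightarrow> 'a \<Rightarrow> complex"
    and Fp Fm :: "'a set"
    and J :: "'a \<Rightarrow> 'a"
  assumes form: "hermitian_form_on smul UNIV ip"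
    and subspace_Fp: "subspace Fp"
    and subspace_Fm: "subspace Fm"
    and sum_decomp: "{u + w | u w. u \<in> Fp \<and> w \<in> Fm} = UNIV"
    and direct_decomp: "Fp \<inter> Fm = {0}"
    and orthogonal_decomp: "\<forall>u\<in>Fp. \<forall>w\<in>Fm. ip u w = 0"
    and hilbert_Fp: "hilbert_space_on smul Fp ip"
    and hilbert_Fm: "hilbert_space_on smul Fm (\<lambda>x y. - ip x y)"
    and fundamental_symmetry: "\<forall>x. J x = component Fp Fm x - component Fm Fp x"

definition standard_two_ip ::
  "('a::ab_group_add \<Rightarrow> 'a \<Rightarrow> complex) \<Rightarrow> 'a set \<Rightarrow> 'a set \<Rightarrow> 'a \<Rightarrow> 'a \<Rightarrow> 'a \<Rightarrow> complex" where
  "standard_two_ip ip Fp Fm x y z =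
     ip (component Fp Fm x) (component Fp Fm y)
       * complex_of_real ((form_norm ip (component Fp Fm z))\<^sup>2) +
     ip (component Fm Fp x) (component Fm Fp y)
       * complex_of_real ((form_norm (\<lambda>u v. - ip u v) (component Fm Fp z))\<^sup>2)"

definition two_inner_product_on ::
  "(complex \<Rightarrow> 'a::ab_group_add \<Rightarrow> 'a) \<Rightarrow> 'a set \<Rightarrow> ('a \<Rightarrow> 'a \<Rightarrow> 'a \<Rightarrow> complex) \<Rightarrow> bool" where
  "two_inner_product_on smul V \<phi> \<longleftrightarrow>
     vector_space smul \<and> module.subspace smul V \<and>
     (\<forall>g\<^sub>1\<in>V. \<forall>g\<^sub>2\<in>V. \<forall>u\<in>V. \<forall>h\<in>V. \<phi> (g\<^sub>1 + g\<^sub>2) u h = \<phi> g\<^sub>1 u h + \<phi> g\<^sub>2 u h) \<and>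
     (\<forall>g\<in>V. \<forall>h\<in>V. \<phi> g g h = \<phi> h h g) \<and>
     (\<forall>g\<in>V. \<forall>u\<in>V. \<forall>h\<in>V. \<phi> u g h = cnj (\<phi> g u h)) \<and>
     (\<forall>a. \<forall>g\<in>V. \<forall>u\<in>V. \<forall>h\<in>V. \<phi> (smul a g) u h = a * \<phi> g u h) \<and>
     (\<forall>g\<in>V. \<forall>h\<in>V. \<phi> g g h \<in> \<real>\<^sub>\<ge>\<^sub>0)"

definition two_norm :: "('a \<Rightarrow> 'a \<Rightarrow> 'a \<Rightarrow> complex) \<Rightarrow> 'a \<Rightarrow> 'a \<Rightarrow> real" where
  "two_norm \<phi> x y = sqrt (Re (\<phi> x x y))"

definition t_Cauchy ::
  "('a::ab_group_add \<Rightarrow> 'a \<Rightarrow> 'a \<Rightarrow> complex) \<Rightarrow> 'a \<Rightarrow> (nat \<Rightarrow> 'a) \<Rightarrow> bool" where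
  "t_Cauchy \<phi> s X \<longleftrightarrow> (\<forall>\<epsilon>>0. \<exists>N. \<forall>m n. m > N \<and> n > N \<longrightarrow> two_norm \<phi> (X n - X m) s < \<epsilon>)"

(* The vector s stands for the component of t that lies in V. *)
definition t_hilbert_space_on ::
  "(complex \<Rightarrow> 'a::ab_group_add \<Rightarrow> 'a) \<Rightarrow> 'a set \<Rightarrow> ('a \<Rightarrow> 'a \<Rightarrow> 'a \<Rightarrow> complex) \<Rightarrow> 'a \<Rightarrow> bool" where
  "t_hilbert_space_on smul V \<phi> s \<longleftrightarrow>
     two_inner_product_on smul V \<phi> \<and>
     (\<forall>X. range X \<subseteq> V \<longrightarrow> t_Cauchy \<phi> s X \<longrightarrow>
        (\<exists>x\<in>V. (\<lambda>n. two_norm \<phi> (X n - x) s) \<longlonglongrightarrow> 0))"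

end

theory Submission
  imports Defs
begin

text \<open>
  On the summand \<open>Fp\<close> of a Krein space one of the two components of every vector vanishes,
  so that \<open>\<psi> x y z = [x, y] \<parallel>z\<parallel>\<^sup>2\<close> there; on \<open>Fm\<close> the same holds for \<open>-\<psi>\<close> and the
  form \<open>-[\<cdot>, \<cdot>]\<close>. Both halves of the claim are therefore instances of one fact about a single
  Hilbert space with form \<open>B\<close>: the function \<open>B x y \<parallel>z\<parallel>\<^sup>2\<close> makes it an \<open>s\<close>-Hilbert space for each
  of its vectors \<open>s\<close> (\<open>t_hilbert_space_on_scaled_form\<close>). The axioms of a two-inner product come from
  those of \<open>B\<close>; the symmetry \<open>\<phi> g g h = \<phi> h h g\<close> holds because both sides are
  \<open>\<parallel>g\<parallel>\<^sup>2 \<parallel>h\<parallel>\<^sup>2\<close>. For completeness, the two-norm against \<open>s\<close> is \<open>\<parallel>x\<parallel> \<parallel>s\<parallel>\<close>. If \<open>\<parallel>s\<parallel> = 0\<close>,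
  it vanishes identically and every sequence converges to every vector; otherwise it is a positive
  multiple of the norm, with the same Cauchy sequences and the same limits.
\<close>

lemma hermitian_form_on_zero:
  assumes "hermitian_form_on smul V B" and "0 \<in> V"
  shows "B 0 0 = 0"
proof -
  have "B (0 + 0) 0 = B 0 0 + B 0 0"
    using assms unfolding hermitian_form_on_def by blast
  then show ?thesis by simp
qed

text \<open>
  Hermitian symmetry makes \<open>B x x\<close> real and positivity makes it nonnegative, so the square root
  in \<^const>\<open>form_norm\<close> loses nothing. This identity is the link between the complex-valued form
  and the real norms.
\<close>

lemma hilbert_space_on_self:
  assumes "hilbert_space_on smul V B" and "x \<in> V"
  shows "B x x = complex_of_real ((form_norm B x)\<^sup>2)"
proof -
  have herm: "hermitian_form_on smul V B"
    and pos: "x \<noteq> 0 \<Longrightarrow> 0 < Re (B x x)"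
    and "module.subspace smul V" and vs: "vector_space smul"
    using assms unfolding hilbert_space_on_def by auto
  interpret vector_space smul by (rule vs)
  have "B 0 0 = 0"
    using hermitian_form_on_zero[OF herm] subspace_0[OF \<open>subspace V\<close>] .
  then have nonneg: "0 \<le> Re (B x x)"
    using pos by (cases "x = 0") auto
  have "B x x = cnj (B x x)"
    using herm assms(2) unfolding hermitian_form_on_def by blast
  then have "B x x = complex_of_real (Re (B x x))"
    by (simp add: complex_eq_iff)
  then show ?thesis
    using nonneg by (simp add: form_norm_def)
qed

lemma two_inner_product_on_scaled_form:
  assumes hs: "hilbert_space_on smul V B"
    and \<phi>: "\<And>x y z. x \<in> V \<Longrightarrow> y \<in> V \<Longrightarrow> z \<in> V \<Longrightarrow>
      \<phi> x y z = B x y * complex_of_real ((form_norm B z)\<^sup>2)"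
  shows "two_inner_product_on smul V \<phi>"
proof -
  have vs: "vector_space smul" and sub: "module.subspace smul V"
    and herm: "hermitian_form_on smul V B"
    using hs unfolding hilbert_space_on_def by auto
  interpret vector_space smul by (rule vs)
  have add: "B (x + y) z = B x z + B y z" if "x \<in> V" "y \<in> V" "z \<in> V" for x y z
    using herm that unfolding hermitian_form_on_def by blast
  have scale: "B (smul a x) y = a * B x y" if "x \<in> V" "y \<in> V" for a x y
    using herm that unfolding hermitian_form_on_def by blast
  have conj: "B y x = cnj (B x y)" if "x \<in> V" "y \<in> V" for x y
    using herm that unfolding hermitian_form_on_def by blast
  have self: "\<phi> g g h = complex_of_real ((form_norm B g)\<^sup>2 * (form_norm B h)\<^sup>2)"
    if "g \<in> V" "h \<in> V" for g h
    using that by (simp add: \<phi> hilbert_space_on_self[OF hs])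
  show ?thesis
    unfolding two_inner_product_on_def
  proof (intro conjI ballI allI)
    fix g u h a assume V: "g \<in> V" "u \<in> V" "h \<in> V"
    show "\<phi> u g h = cnj (\<phi> g u h)"
      using V conj[of g u] by (simp add: \<phi>)
    show "\<phi> (smul a g) u h = a * \<phi> g u h"
      using V subspace_scale[OF sub] by (simp add: \<phi> scale)
  next
    fix g\<^sub>1 g\<^sub>2 u h assume V: "g\<^sub>1 \<in> V" "g\<^sub>2 \<in> V" "u \<in> V" "h \<in> V"
    show "\<phi> (g\<^sub>1 + g\<^sub>2) u h = \<phi> g\<^sub>1 u h + \<phi> g\<^sub>2 u h"
      using V subspace_add[OF sub] by (simp add: \<phi> add algebra_simps)
  next
    fix g h assume V: "g \<in> V" "h \<in> V"
    show "\<phi> g g h = \<phi> h h g"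
      using V by (simp add: self mult.commute)
    show "\<phi> g g h \<in> \<real>\<^sub>\<ge>\<^sub>0"
      unfolding self[OF V] by (simp only: nonneg_Reals_of_real_iff) simp
  qed (rule vs sub)+
qed

text \<open>
  The two-norm against \<open>s\<close> is the norm of \<open>B\<close> multiplied by the constant \<open>\<parallel>s\<parallel>\<close>, so for
  \<open>\<parallel>s\<parallel> \<noteq> 0\<close> completeness is inherited after rescaling \<open>\<epsilon>\<close>. The formula for \<open>\<phi>\<close> is required only on
  \<open>V\<close>, because the standardized two-inner product has this form only on each summand.
\<close>

lemma t_hilbert_space_on_scaled_form:
  assumes hs: "hilbert_space_on smul V B" and s: "s \<in> V"
    and \<phi>: "\<And>x y z. x \<in> V \<Longrightarrow> y \<in> V \<Longrightarrow> z \<in> V \<Longrightarrow>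
      \<phi> x y z = B x y * complex_of_real ((form_norm B z)\<^sup>2)"
  shows "t_hilbert_space_on smul V \<phi> s"
proof -
  have vs: "vector_space smul" and sub: "module.subspace smul V"
    using hs unfolding hilbert_space_on_def by auto
  interpret vector_space smul by (rule vs)
  have nonneg: "0 \<le> form_norm B x" if "x \<in> V" for x
  proof -
    have "Re (B x x) = (form_norm B x)\<^sup>2"
      using hilbert_space_on_self[OF hs that] by simp
    then have "0 \<le> Re (B x x)" by (metis zero_le_power2)
    then show ?thesis by (simp add: form_norm_def)
  qed
  have norm: "two_norm \<phi> x s = form_norm B x * form_norm B s" if "x \<in> V" for x
  proof -
    have "\<phi> x x s = complex_of_real ((form_norm B x * form_norm B s)\<^sup>2)"
      using that s by (simp add: \<phi> hilbert_space_on_self[OF hs] power_mult_distrib)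
    then show ?thesis
      using nonneg[OF that] nonneg[OF s] by (simp add: two_norm_def del: of_real_power of_real_mult)
  qed
  have diff: "x - y \<in> V" if "x \<in> V" "y \<in> V" for x y
    using subspace_diff[OF sub] that .
  have "\<exists>x\<in>V. (\<lambda>n. two_norm \<phi> (X n - x) s) \<longlonglongrightarrow> 0"
    if X: "range X \<subseteq> V" and cauchy: "t_Cauchy \<phi> s X" for X
  proof (cases "form_norm B s = 0")
    case True
    have "two_norm \<phi> (X n - 0) s = 0" for n
      using X True by (subst norm) (auto intro: diff subspace_0[OF sub])
    then show ?thesis
      using subspace_0[OF sub] by (intro bexI[of _ 0]) auto
  next
    case False
    then have pos: "0 < form_norm B s"
      using nonneg[OF s] by simp
    have XV: "X n \<in> V" for n using X by auto
    have "\<exists>N. \<forall>m\<ge>N. \<forall>n\<ge>N. form_norm B (X m - X n) < \<epsilon>" if "\<epsilon> > 0" for \<epsilon>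
    proof -
      have "\<epsilon> * form_norm B s > 0" using that pos by simp
      then obtain N where N: "\<And>m n. m > N \<Longrightarrow> n > N \<Longrightarrow>
          two_norm \<phi> (X n - X m) s < \<epsilon> * form_norm B s"
        using cauchy unfolding t_Cauchy_def by blast
      have "form_norm B (X m - X n) < \<epsilon>" if "m \<ge> Suc N" "n \<ge> Suc N" for m n
        using N[of n m] that pos by (simp add: norm diff XV)
      then show ?thesis by blast
    qed
    then obtain x where x: "x \<in> V" and lim: "(\<lambda>n. form_norm B (X n - x)) \<longlonglongrightarrow> 0"
      using hs X unfolding hilbert_space_on_def by metis
    have "(\<lambda>n. form_norm B (X n - x) * form_norm B s) \<longlonglongrightarrow> 0"
      using tendsto_mult_right[OF lim] by simp
    then show ?thesis
      using x by (intro bexI[of _ x]) (auto simp: norm diff XV)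
  qed
  moreover have "two_inner_product_on smul V \<phi>"
    using hs \<phi> by (rule two_inner_product_on_scaled_form)
  ultimately show ?thesis
    unfolding t_hilbert_space_on_def by blast
qed

context module
begin

text \<open>
  Two decompositions of one vector differ by an element of \<open>U \<inter> W\<close>, so the definite description in
  \<^const>\<open>component\<close> has a unique witness.
\<close>

lemma component_add:
  assumes "subspace U" "subspace W" "U \<inter> W = {0}" "u \<in> U" "w \<in> W"
  shows "component U W (u + w) = u"
  unfolding component_def
proof (rule the_equality)
  show "u \<in> U \<and> (\<exists>w'\<in>W. u + w = u + w')" using assms by blast
next
  fix v assume v: "v \<in> U \<and> (\<exists>w'\<in>W. u + w = v + w')"
  then obtain w' where w': "w' \<in> W" "u + w = v + w'" by blast
  then have "v - u = w - w'" by (simp add: algebra_simps)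
  moreover have "v - u \<in> U" "w - w' \<in> W"
    using assms v w' subspace_diff by blast+
  ultimately have "v - u \<in> U \<inter> W" by simp
  then show "v = u" using assms(3) by simp
qed

lemma component_of_summand:
  assumes "subspace U" "subspace W" "U \<inter> W = {0}" "u \<in> U"
  shows "component U W u = u" "component W U u = 0"
proof -
  show "component U W u = u"
    using component_add[OF assms subspace_0[OF assms(2)]] by simp
  have "W \<inter> U = {0}" using assms(3) by blast
  then show "component W U u = 0"
    using component_add[of W U 0 u] assms subspace_0 by simp
qed

end

theorem proposition3p4:
  fixes smul :: "complex \<Rightarrow> 'a::ab_group_add \<Rightarrow> 'a"
    and ip :: "'a \<Rightarrow> 'a \<Rightarrow> complex"
    and Fp Fm :: "'a set"
    and J :: "'a \<Rightarrow> 'a"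
    and \<psi> :: "'a \<Rightarrow> 'a \<Rightarrow> 'a \<Rightarrow> complex"
    and t :: 'a
  assumes "krein_space smul ip Fp Fm J"
    and "\<psi> = standard_two_ip ip Fp Fm"
  shows "t_hilbert_space_on smul Fp \<psi> (component Fp Fm t) \<and>
         t_hilbert_space_on smul Fm (\<lambda>x y z. - \<psi> x y z) (component Fm Fp t)"
proof -
  interpret krein_space smul ip Fp Fm J by (rule assms(1))
  have direct': "Fm \<inter> Fp = {0}" using direct_decomp by blast
  note on_Fp = component_of_summand[OF subspace_Fp subspace_Fm direct_decomp]
  note on_Fm = component_of_summand[OF subspace_Fm subspace_Fp direct']
  have zero: "ip 0 0 = 0"
    using form by (rule hermitian_form_on_zero) simp
  obtain u w where uw: "u \<in> Fp" "w \<in> Fm" "t = u + w"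
    using sum_decomp by blast
  have "component Fp Fm t = u"
    using component_add[OF subspace_Fp subspace_Fm direct_decomp] uw by simp
  then have tp: "component Fp Fm t \<in> Fp" using uw by simp
  have "component Fm Fp t = w"
    using component_add[OF subspace_Fm subspace_Fp direct', of w u] uw by (simp add: add.commute)
  then have tm: "component Fm Fp t \<in> Fm" using uw by simp
  have "t_hilbert_space_on smul Fp \<psi> (component Fp Fm t)"
    using hilbert_Fp tp
    by (rule t_hilbert_space_on_scaled_form)
       (simp add: assms(2) standard_two_ip_def on_Fp zero)
  moreover have "t_hilbert_space_on smul Fm (\<lambda>x y z. - \<psi> x y z) (component Fm Fp t)"
    using hilbert_Fm tm
    by (rule t_hilbert_space_on_scaled_form)
       (simp add: assms(2) standard_two_ip_def on_Fm zero)
  ultimately show ?thesis ..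
qed

end
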